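(* Consider the cycle graph $C_n$ with vertex set $V=[n]$ and edge set $E$ consisting of all edges $(i,i+1)$, $i\in[n]$, with indices taken modulo $n$. Let $w_i$ denote the weight of the edge $(i,i+1)$. There exists a rank-$1$ optimal solution to the primal max-cut SDP of the weighted graph $(C_n,w)$ if and only if at least one of the following statements is true: (1) there are an even number of positively weighted edges in the graph; (2) there exists a weight $w_m$ such that $$\frac{1}{|w_m|}\ \ge\ \sum_{i\neq m}\frac{1}{|w_i|}.$$
   Context: For a graph $G=([n],E)$ with fixed real edge weights $\{w_{ij}\}_{ij\in E}$, the Laplacian $L(G,w)$ is the symmetric $n\times n$ matrix with $L(G,w)_{ij}=-w_{ij}$ if $ij\in E$, $L(G,w)_{ii}=\sum_{k: ik\in E} w_{ik}$, and all other entries $0$. The primal max-cut SDP of $(G,w)$ is: maximize $\frac14\operatorname{Tr}(L(G,w)X)$ over real symmetric $n\times n$ matrices $X$ subject to $X_{ii}=1$ for all $i\in[n]$ and $X\succeq 0$ (positive semidefinite). *)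

theory Defs
  imports "Jordan_Normal_Form.DL_Rank" "HOL-Library.Extended_Real"
begin

text \<open>
  Graphs have vertex set \<open>{0..<n}\<close> (instead of \<open>{1..n}\<close>, matching the index range of matrices)
  and edges that are two-element sets of vertices; edge weights are functions on edges.
\<close>

definition laplacian :: "nat \<Rightarrow> nat set set \<Rightarrow> (nat set \<Rightarrow> real) \<Rightarrow> real mat" where
  "laplacian n E w = mat n n (\<lambda>(i, j).
     if i = j then (\<Sum>k | k < n \<and> {i, k} \<in> E. w {i, k})
     else if {i, j} \<in> E then - w {i, j}
     else 0)"

definition mat_trace :: "'a :: comm_monoid_add mat \<Rightarrow> 'a" where
  "mat_trace A = (\<Sum>i<dim_row A. A $$ (i, i))"

definition psd_mat :: "nat \<Rightarrow> real mat \<Rightarrow> bool" where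
  "psd_mat n X \<longleftrightarrow> X \<in> carrier_mat n n \<and> transpose_mat X = X \<and>
     (\<forall>v \<in> carrier_vec n. v \<bullet> (X *\<^sub>v v) \<ge> 0)"

definition maxcut_sdp_feasible :: "nat \<Rightarrow> real mat \<Rightarrow> bool" where
  "maxcut_sdp_feasible n X \<longleftrightarrow> psd_mat n X \<and> (\<forall>i<n. X $$ (i, i) = 1)"

definition maxcut_sdp_objective ::
  "nat \<Rightarrow> nat set set \<Rightarrow> (nat set \<Rightarrow> real) \<Rightarrow> real mat \<Rightarrow> real" where
  "maxcut_sdp_objective n E w X = 1 / 4 * mat_trace (laplacian n E w * X)"

definition maxcut_sdp_optimal ::
  "nat \<Rightarrow> nat set set \<Rightarrow> (nat set \<Rightarrow> real) \<Rightarrow> real mat \<Rightarrow> bool" where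
  "maxcut_sdp_optimal n E w X \<longleftrightarrow> maxcut_sdp_feasible n X \<and>
     (\<forall>Y. maxcut_sdp_feasible n Y \<longrightarrow> maxcut_sdp_objective n E w Y \<le> maxcut_sdp_objective n E w X)"

definition cycle_edge :: "nat \<Rightarrow> nat \<Rightarrow> nat set" where
  "cycle_edge n i = {i, (i + 1) mod n}"

text \<open>A simple cycle with \<open>n\<close> pairwise distinct edges only for \<open>n \<ge> 3\<close>.\<close>

definition cycle_edges :: "nat \<Rightarrow> nat set set" where
  "cycle_edges n = cycle_edge n ` {0..<n}"

text \<open>
  The reciprocal of the absolute value of a weight is taken in the extended reals, where
  \<open>1 / 0 = \<infinity>\<close>; in the reals, \<open>1 / 0\<close> would be \<open>0\<close>. For nonzero weights it is the real reciprocal.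
\<close>

definition recip_abs :: "real \<Rightarrow> ereal" where
  "recip_abs x = 1 / ereal \<bar>x\<bar>"

end

theory Submission
  imports Defs
begin

text \<open>
  On the cycle the objective is \<open>1/2 * (\<Sum>j. w\<^sub>j * (1 - X\<^sub>j\<^sub>,\<^sub>j\<^sub>+\<^sub>1))\<close>, and the feasible matrices of rank one are
  \<open>X\<^sub>i\<^sub>j = s\<^sub>i * s\<^sub>j\<close> for a sign vector \<open>s\<close>; the edge signs \<open>s\<^sub>j * s\<^sub>j\<^sub>+\<^sub>1\<close> are arbitrary up to having product 1.
  If the number of positive weights is even, every term \<open>w\<^sub>j * X\<^sub>j\<^sub>,\<^sub>j\<^sub>+\<^sub>1\<close> can be made \<open>-\<bar>w\<^sub>j\<bar>\<close>. If it is
  odd, some edge \<open>m\<close> has the wrong sign. Flipping only \<open>m\<close> is optimal when \<open>1 / \<bar>w\<^sub>m\<bar>\<close> dominates, by the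
  Cauchy-Schwarz inequality with weights \<open>\<bar>w\<^sub>j\<bar>\<close> applied to the differences
  \<open>s\<^sub>j * e\<^sub>j - s\<^sub>j\<^sub>+\<^sub>1 * e\<^sub>j\<^sub>+\<^sub>1\<close>, whose sum around the cycle vanishes. When it does not dominate, rotating the
  sign vectors in the plane by small angles proportional to \<open>1 / \<bar>w\<^sub>j\<bar>\<close> along the other edges improves
  the objective to second order.
\<close>

section \<open>Feasible matrices as bilinear forms\<close>

text \<open>Vectors are plain functions of which only the values below \<open>n\<close> count, so
  linear combinations can be formed without dimension conditions.\<close>

definition bilin :: "nat \<Rightarrow> real mat \<Rightarrow> (nat \<Rightarrow> real) \<Rightarrow> (nat \<Rightarrow> real) \<Rightarrow> real" where
  "bilin n X u v = (\<Sum>i<n. \<Sum>j<n. u i * v j * X $$ (i, j))"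

definition unit_fun :: "nat \<Rightarrow> nat \<Rightarrow> real" where
  "unit_fun a i = (if i = a then 1 else 0)"

lemma bilin_add_left: "bilin n X (\<lambda>i. u i + u' i) v = bilin n X u v + bilin n X u' v"
  by (simp add: bilin_def algebra_simps sum.distrib)

lemma bilin_add_right: "bilin n X u (\<lambda>i. v i + v' i) = bilin n X u v + bilin n X u v'"
  by (simp add: bilin_def algebra_simps sum.distrib)

lemma bilin_scale_left: "bilin n X (\<lambda>i. c * u i) v = c * bilin n X u v"
  by (simp add: bilin_def sum_distrib_left mult_ac)

lemma bilin_scale_right: "bilin n X u (\<lambda>i. c * v i) = c * bilin n X u v"
  by (simp add: bilin_def sum_distrib_left mult_ac)

lemma bilin_sum_left:
  assumes "finite A"
  shows "bilin n X (\<lambda>i. \<Sum>k\<in>A. y k i) v = (\<Sum>k\<in>A. bilin n X (y k) v)"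
  using assms
proof (induction A rule: finite_induct)
  case empty
  then show ?case by (simp add: bilin_def)
next
  case (insert k A)
  then show ?case by (simp add: bilin_add_left)
qed

lemmas bilin_simps = bilin_add_left bilin_add_right bilin_scale_left bilin_scale_right

lemma bilin_unit:
  assumes "a < n" "b < n"
  shows "bilin n X (unit_fun a) (unit_fun b) = X $$ (a, b)"
proof -
  have "bilin n X (unit_fun a) (unit_fun b)
      = (\<Sum>i<n. \<Sum>j<n. if i = a then if j = b then X $$ (i, j) else 0 else 0)"
    unfolding bilin_def unit_fun_def by (intro sum.cong refl) simp
  also have "\<dots> = (\<Sum>i<n. if i = a then (\<Sum>j<n. if j = b then X $$ (i, j) else 0) else 0)"
    by (intro sum.cong refl) simp
  finally show ?thesis
    using assms by simp
qed

lemma scalar_prod_mult_mat_vec: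
  assumes "X \<in> carrier_mat n n" "v \<in> carrier_vec n"
  shows "v \<bullet> (X *\<^sub>v v) = bilin n X (\<lambda>i. v $ i) (\<lambda>i. v $ i)"
  using assms
  by (auto simp: bilin_def scalar_prod_def sum_distrib_left lessThan_atLeast0 mult_ac intro!: sum.cong)

lemma feasible_iff:
  "maxcut_sdp_feasible n X \<longleftrightarrow>
     X \<in> carrier_mat n n \<and> (\<forall>i<n. \<forall>j<n. X $$ (i, j) = X $$ (j, i)) \<and>
     (\<forall>u. bilin n X u u \<ge> 0) \<and> (\<forall>i<n. X $$ (i, i) = 1)"
proof (cases "X \<in> carrier_mat n n")
  case True
  have "transpose_mat X = X \<longleftrightarrow> (\<forall>i<n. \<forall>j<n. X $$ (i, j) = X $$ (j, i))"
    using True by (auto simp: mat_eq_iff)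
  moreover have "(\<forall>v \<in> carrier_vec n. v \<bullet> (X *\<^sub>v v) \<ge> 0) \<longleftrightarrow> (\<forall>u. bilin n X u u \<ge> 0)"
  proof
    assume psd: "\<forall>v \<in> carrier_vec n. v \<bullet> (X *\<^sub>v v) \<ge> 0"
    show "\<forall>u. bilin n X u u \<ge> 0"
    proof
      fix u
      have "bilin n X u u = bilin n X (\<lambda>i. vec n u $ i) (\<lambda>i. vec n u $ i)"
        by (simp add: bilin_def)
      also have "\<dots> = vec n u \<bullet> (X *\<^sub>v vec n u)"
        using scalar_prod_mult_mat_vec[OF True, of "vec n u"] by simp
      finally show "bilin n X u u \<ge> 0"
        using psd by simp
    qed
  qed (simp add: scalar_prod_mult_mat_vec[OF True])
  ultimately show ?thesis
    using True by (simp add: maxcut_sdp_feasible_def psd_mat_def)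
qed (simp add: maxcut_sdp_feasible_def psd_mat_def)

lemma
  assumes "maxcut_sdp_feasible n X"
  shows feasible_carrier: "X \<in> carrier_mat n n"
    and feasible_sym: "i < n \<Longrightarrow> j < n \<Longrightarrow> X $$ (i, j) = X $$ (j, i)"
    and feasible_bilin_nonneg: "bilin n X u u \<ge> 0"
    and feasible_diag: "i < n \<Longrightarrow> X $$ (i, i) = 1"
  using assms unfolding feasible_iff by blast+

lemma feasible_bilin_sym:
  assumes "maxcut_sdp_feasible n X"
  shows "bilin n X u v = bilin n X v u"
proof -
  have "bilin n X u v = (\<Sum>j<n. \<Sum>i<n. u i * v j * X $$ (i, j))"
    unfolding bilin_def by (rule sum.swap)
  also have "\<dots> = bilin n X v u"
    unfolding bilin_def using feasible_sym[OF assms]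
    by (intro sum.cong refl) (simp add: mult_ac)
  finally show ?thesis .
qed

lemma bilin_unit_combination:
  assumes "maxcut_sdp_feasible n X" "a < n" "b < n"
  shows "bilin n X (\<lambda>i. s * unit_fun a i + t * unit_fun b i) (\<lambda>i. s * unit_fun a i + t * unit_fun b i)
    = s\<^sup>2 + t\<^sup>2 + 2 * (s * t) * X $$ (a, b)"
  using assms feasible_diag[OF assms(1)] feasible_sym[OF assms(1), of a b]
  by (simp add: bilin_simps bilin_unit power2_eq_square algebra_simps)

text \<open>Semidefiniteness tested on the sum and the difference of two basis vectors gives
  \<open>2 + 2 * X $$ (a, b) \<ge> 0\<close> and \<open>2 - 2 * X $$ (a, b) \<ge> 0\<close>.\<close>

lemma feasible_entry_abs_le_1:
  assumes "maxcut_sdp_feasible n X" "a < n" "b < n"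
  shows "\<bar>X $$ (a, b)\<bar> \<le> 1"
  using bilin_unit_combination[OF assms, of 1 1] bilin_unit_combination[OF assms, of 1 "-1"]
    feasible_bilin_nonneg[OF assms(1), of "\<lambda>i. 1 * unit_fun a i + 1 * unit_fun b i"]
    feasible_bilin_nonneg[OF assms(1), of "\<lambda>i. 1 * unit_fun a i + (-1) * unit_fun b i"]
  by (simp add: abs_le_iff)

text \<open>The difference of the two sides, divided by \<open>T\<close>, is a weighted sum of
  values of the semidefinite form at the vectors \<open>y i + c i * z\<close>.\<close>

lemma weighted_Cauchy_Schwarz:
  assumes X: "maxcut_sdp_feasible n X" and fin: "finite A"
    and a: "\<And>i. i \<in> A \<Longrightarrow> a i > 0"
    and T: "(\<Sum>i\<in>A. 1 / a i) = T" "T > 0"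
    and z: "\<And>k. z k = (\<Sum>i\<in>A. y i k)"
  shows "bilin n X z z \<le> T * (\<Sum>i\<in>A. a i * bilin n X (y i) (y i))"
proof -
  \<comment> \<open>Among families with sum \<open>z\<close>, the choice
    \<open>y i = z / (a i * T)\<close> minimises the right-hand side; \<open>y i + c i * z\<close>
    is the deviation from it.\<close>
  define c where "c i = - 1 / (a i * T)" for i
  have "0 \<le> (\<Sum>i\<in>A. a i * bilin n X (\<lambda>k. y i k + c i * z k) (\<lambda>k. y i k + c i * z k))"
    by (intro sum_nonneg mult_nonneg_nonneg feasible_bilin_nonneg[OF X]) (use a in force)
  also have "\<dots> = (\<Sum>i\<in>A. a i * bilin n X (y i) (y i) - 2 / T * bilin n X (y i) z
                     + bilin n X z z / T\<^sup>2 * (1 / a i))"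
  proof (intro sum.cong refl)
    fix i assume "i \<in> A"
    then have ai: "a i > 0" by (rule a)
    have "a i * bilin n X (\<lambda>k. y i k + c i * z k) (\<lambda>k. y i k + c i * z k)
      = a i * bilin n X (y i) (y i) + 2 * (a i * c i) * bilin n X (y i) z
        + a i * (c i)\<^sup>2 * bilin n X z z"
      by (simp add: bilin_simps feasible_bilin_sym[OF X, of z "y i"] power2_eq_square algebra_simps)
    moreover have "a i * c i = - 1 / T" "a i * (c i)\<^sup>2 = 1 / (a i * T\<^sup>2)"
      using ai T(2) by (simp_all add: c_def power2_eq_square)
    ultimately show "a i * bilin n X (\<lambda>k. y i k + c i * z k) (\<lambda>k. y i k + c i * z k)
      = a i * bilin n X (y i) (y i) - 2 / T * bilin n X (y i) z + bilin n X z z / T\<^sup>2 * (1 / a i)"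
      by simp
  qed
  also have "\<dots> = (\<Sum>i\<in>A. a i * bilin n X (y i) (y i)) - 2 / T * (\<Sum>i\<in>A. bilin n X (y i) z)
                   + bilin n X z z / T\<^sup>2 * T"
    unfolding T(1)[symmetric]
    by (simp only: sum.distrib sum_subtractf sum_distrib_left)
  also have "(\<Sum>i\<in>A. bilin n X (y i) z) = bilin n X z z"
    using bilin_sum_left[OF fin, of n X y z] z by (metis (no_types, lifting) ext)
  finally have "0 \<le> (\<Sum>i\<in>A. a i * bilin n X (y i) (y i)) - bilin n X z z / T"
    using T(2) by (simp add: power2_eq_square field_simps)
  then show ?thesis
    using T(2) by (simp add: field_simps)
qed

lemma sum_product_square:
  fixes f :: "nat \<Rightarrow> real"
  shows "(\<Sum>i<n. \<Sum>j<n. f i * f j) = (\<Sum>i<n. f i)\<^sup>2"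
  by (simp add: power2_eq_square sum_product)

text \<open>These are the Gram matrices of the vectors \<open>s i *\<^sub>R (cos (\<phi> i), sin (\<phi> i))\<close> in the plane.\<close>

lemma planar_feasible:
  fixes s \<phi> :: "nat \<Rightarrow> real"
  assumes "\<And>i. i < n \<Longrightarrow> s i * s i = 1"
  shows "maxcut_sdp_feasible n (mat n n (\<lambda>(i, j). s i * s j * cos (\<phi> i - \<phi> j)))" (is "maxcut_sdp_feasible n ?X")
proof -
  have "bilin n ?X u u \<ge> 0" for u
  proof -
    have "bilin n ?X u u = (\<Sum>i<n. \<Sum>j<n. (u i * s i * cos (\<phi> i)) * (u j * s j * cos (\<phi> j))
        + (u i * s i * sin (\<phi> i)) * (u j * s j * sin (\<phi> j)))"
      unfolding bilin_def by (intro sum.cong refl) (simp add: cos_diff algebra_simps)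
    also have "\<dots> = (\<Sum>i<n. u i * s i * cos (\<phi> i))\<^sup>2 + (\<Sum>i<n. u i * s i * sin (\<phi> i))\<^sup>2"
      by (simp only: sum.distrib sum_product_square)
    finally show ?thesis by simp
  qed
  moreover have "cos (\<phi> i - \<phi> j) = cos (\<phi> j - \<phi> i)" for i j
    by (metis cos_minus minus_diff_eq)
  ultimately show ?thesis
    unfolding feasible_iff using assms by (auto simp: mult_ac)
qed

section \<open>Feasible matrices of rank one\<close>

text \<open>Product entries bound the rank by 1. Column 0 alone is independent because its top entry
  \<open>s 0 * s 0\<close> is nonzero.\<close>

lemma rank_one_sign_mat:
  fixes s :: "nat \<Rightarrow> real"
  assumes "n > 0" "s 0 \<noteq> 0"
  shows "vec_space.rank n (mat n n (\<lambda>(i, j). s i * s j)) = 1" (is "vec_space.rank n ?X = 1")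
proof -
  interpret vec_space "TYPE(real)" n .
  have X: "?X \<in> carrier_mat n n" by simp
  have "rank ?X \<le> 1"
    by (rule rank_le_1_product_entries[OF X]) auto
  moreover have "rank ?X \<ge> card {col ?X 0}"
  proof (rule rank_ge_card_indpt[OF X])
    show "{col ?X 0} \<subseteq> set (cols ?X)"
      using assms(1) by (auto simp: cols_def)
    show "lin_indpt {col ?X 0}"
    proof (rule finite_lin_indpt2)
      fix a assume "lincomb a {col ?X 0} = 0\<^sub>v n"
      then have "lincomb a {col ?X 0} $ 0 = 0"
        using assms(1) by simp
      then show "\<forall>v\<in>{col ?X 0}. a v = 0"
        using assms by (subst (asm) lincomb_index) auto
    qed (use assms(1) col_carrier_vec[OF _ X] in auto)
  qed
  ultimately show ?thesis by simp
qed

lemma rank_one_columns_dependent: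
  assumes X: "X \<in> carrier_mat n n" and rk: "vec_space.rank n X = 1" and ij: "i < n" "j < n"
  obtains a b :: real where "a \<noteq> 0 \<or> b \<noteq> 0" "\<And>r. r < n \<Longrightarrow> a * X $$ (r, i) + b * X $$ (r, j) = 0"
\<comment> \<open>Equal columns form a singleton set, about which the rank says nothing; the
  coefficients 1 and -1 serve there.\<close>
proof (cases "col X i = col X j")
  case True
  have "1 * X $$ (r, i) + (-1) * X $$ (r, j) = 0" if "r < n" for r
    using that X ij arg_cong[OF True, of "\<lambda>v. v $ r"] by simp
  then show ?thesis
    using that[of 1 "-1"] by simp
next
  case False
  interpret vec_space "TYPE(real)" n .
  have "\<not> lin_indpt {col X i, col X j}"
  proof
    assume "lin_indpt {col X i, col X j}"
    then have "card {col X i, col X j} \<le> rank X"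
      using X ij by (intro rank_ge_card_indpt) (auto simp: cols_def)
    with False rk show False by simp
  qed
  then obtain f where f: "lincomb f {col X i, col X j} = 0\<^sub>v n" "f (col X i) \<noteq> 0 \<or> f (col X j) \<noteq> 0"
    using X ij finite_lin_indpt2[of "{col X i, col X j}"] by auto
  have "f (col X i) * X $$ (r, i) + f (col X j) * X $$ (r, j) = 0" if "r < n" for r
  proof -
    have "lincomb f {col X i, col X j} $ r = 0"
      using f that by simp
    then show ?thesis
      using X ij that False by (subst (asm) lincomb_index) auto
  qed
  with f show ?thesis using that by blast
qed

text \<open>The signs are row 0 of \<open>X\<close>. Column \<open>j\<close> depends on column 0;
  row 0 of the dependence fixes the ratio of the coefficients, the other rows give the product form,
  and the unit diagonal gives the squares.\<close>

lemma feasible_rank_one: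
  assumes X: "maxcut_sdp_feasible n X" and rk: "vec_space.rank n X = 1" and "n > 0"
  obtains s where "\<And>i. i < n \<Longrightarrow> s i * s i = 1" "\<And>i j. i < n \<Longrightarrow> j < n \<Longrightarrow> X $$ (i, j) = s i * s j"
proof -
  define s where "s i = X $$ (0, i)" for i
  have key: "s j * s j = 1 \<and> (\<forall>r<n. X $$ (r, j) = s r * s j)" if j: "j < n" for j
  proof -
    obtain a b where ab: "a \<noteq> 0 \<or> b \<noteq> 0" "\<And>r. r < n \<Longrightarrow> a * X $$ (r, 0) + b * X $$ (r, j) = 0"
      using rank_one_columns_dependent[OF feasible_carrier[OF X] rk \<open>n > 0\<close> j] by blast
    have rows: "a * s r + b * X $$ (r, j) = 0" if "r < n" for r
      using ab(2)[OF that] feasible_sym[OF X that \<open>n > 0\<close>] by (simp add: s_def)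
    have a: "a = - b * s j"
      using rows[OF \<open>n > 0\<close>] feasible_diag[OF X \<open>n > 0\<close>] by (simp add: s_def)
    with ab have b: "b \<noteq> 0" by auto
    have prod: "X $$ (r, j) = s r * s j" if "r < n" for r
    proof -
      have "b * X $$ (r, j) = b * (s r * s j)"
        using rows[OF that] a by (simp add: algebra_simps)
      with b show ?thesis by simp
    qed
    with j show ?thesis
      using feasible_diag[OF X j] by metis
  qed
  then show ?thesis using that by blast
qed

section \<open>The objective on a cycle\<close>

text \<open>For \<open>n = 2\<close> both indices would name the same edge; from
  \<open>n = 3\<close> on, sums over edges and over indices agree.\<close>

lemma cycle_edge_inj:
  assumes "n \<ge> 3"
  shows "inj_on (cycle_edge n) {..<n}"
proof (rule inj_onI)
  fix i j assume "i \<in> {..<n}" "j \<in> {..<n}" "cycle_edge n i = cycle_edge n j"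
  with assms show "i = j"
    by (auto simp: cycle_edge_def doubleton_eq_iff mod_Suc split: if_splits)
qed

lemma cycle_edge_no_loop:
  fixes n i :: nat
  assumes "n \<ge> 3" "i < n"
  shows "(i + 1) mod n \<noteq> i" "(i + 1) mod n < n"
  using assms by (auto simp: mod_Suc)

text \<open>This is the decomposition of the Laplacian into rank-one terms, one for the difference
  of the two basis vectors of each edge.\<close>

lemma laplacian_cycle_entry:
  assumes n: "n \<ge> 3" and ik: "i < n" "k < n"
  shows "laplacian n (cycle_edges n) w $$ (i, k) =
    (\<Sum>j<n. w (cycle_edge n j) * ((unit_fun j i - unit_fun ((j + 1) mod n) i) *
                                   (unit_fun j k - unit_fun ((j + 1) mod n) k)))"
    (is "_ = ?rhs")
proof (cases "i = k")
  case True
  let ?K = "{k. k < n \<and> {i, k} \<in> cycle_edges n}"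
  let ?J = "{j. j < n \<and> i \<in> cycle_edge n j}"
  \<comment> \<open>The degree sum runs over neighbours of \<open>i\<close>, the right-hand side
    over edge indices; both enumerate the edges incident to \<open>i\<close>.\<close>
  have img: "(\<lambda>k. {i, k}) ` ?K = cycle_edge n ` ?J"
  proof (intro equalityI subsetI)
    fix e assume "e \<in> (\<lambda>k. {i, k}) ` ?K"
    then show "e \<in> cycle_edge n ` ?J"
      by (fastforce simp: cycle_edges_def)
  next
    fix e assume "e \<in> cycle_edge n ` ?J"
    then obtain j where j: "j < n" "i \<in> cycle_edge n j" "e = cycle_edge n j" by blast
    then obtain k where "k < n" "e = {i, k}"
      using cycle_edge_no_loop[OF n j(1)] ik(1) unfolding cycle_edge_def by blast
    with j show "e \<in> (\<lambda>k. {i, k}) ` ?K"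
      by (auto simp: cycle_edges_def)
  qed
  have "laplacian n (cycle_edges n) w $$ (i, k) = (\<Sum>k\<in>?K. w {i, k})"
    using ik True by (simp add: laplacian_def)
  also have "\<dots> = sum w ((\<lambda>k. {i, k}) ` ?K)"
    by (subst sum.reindex) (auto simp: inj_on_def doubleton_eq_iff)
  also have "\<dots> = (\<Sum>j\<in>?J. w (cycle_edge n j))"
    unfolding img using cycle_edge_inj[OF n]
    by (subst sum.reindex) (auto intro: inj_on_subset)
  also have "\<dots> = (\<Sum>j<n. if i \<in> cycle_edge n j then w (cycle_edge n j) else 0)"
    by (simp add: sum.inter_filter[symmetric] lessThan_def)
  also have "\<dots> = ?rhs"
  proof (intro sum.cong refl)
    fix j assume "j \<in> {..<n}"
    then show "(if i \<in> cycle_edge n j then w (cycle_edge n j) else 0) =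
      w (cycle_edge n j) * ((unit_fun j i - unit_fun ((j + 1) mod n) i) *
                            (unit_fun j k - unit_fun ((j + 1) mod n) k))"
      using cycle_edge_no_loop(1)[OF n, of j] True by (auto simp: unit_fun_def cycle_edge_def)
  qed
  finally show ?thesis .
next
  case False
  have entry: "w (cycle_edge n j) * ((unit_fun j i - unit_fun ((j + 1) mod n) i) *
      (unit_fun j k - unit_fun ((j + 1) mod n) k)) = (if cycle_edge n j = {i, k} then - w {i, k} else 0)"
    if "j < n" for j
    using cycle_edge_no_loop[OF n that] False
    by (auto simp: unit_fun_def cycle_edge_def doubleton_eq_iff insert_commute)
  have "?rhs = (\<Sum>j<n. if cycle_edge n j = {i, k} then - w {i, k} else 0)"
    using entry by (intro sum.cong refl) blast
  also have "\<dots> = (\<Sum>e\<in>cycle_edges n. if e = {i, k} then - w {i, k} else 0)"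
    unfolding cycle_edges_def lessThan_atLeast0[symmetric] using cycle_edge_inj[OF n]
    by (subst sum.reindex) (auto simp: comp_def)
  also have "\<dots> = laplacian n (cycle_edges n) w $$ (i, k)"
    using ik False by (simp add: laplacian_def cycle_edges_def)
  finally show ?thesis ..
qed

text \<open>By the edge decomposition the trace is a weighted sum of the form at the edge vectors
  \<open>d j\<close>, and the unit diagonal evaluates each of these to
  \<open>2 * (1 - X $$ (j, (j + 1) mod n))\<close>.\<close>

lemma objective_cycle:
  assumes n: "n \<ge> 3" and X: "maxcut_sdp_feasible n X"
  shows "maxcut_sdp_objective n (cycle_edges n) w X =
    1 / 2 * (\<Sum>j<n. w (cycle_edge n j) * (1 - X $$ (j, (j + 1) mod n)))"
proof -
  define d where "d j i = 1 * unit_fun j i + (-1) * unit_fun ((j + 1) mod n) i" for j i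
  have "mat_trace (laplacian n (cycle_edges n) w * X)
      = (\<Sum>i<n. \<Sum>k<n. laplacian n (cycle_edges n) w $$ (i, k) * X $$ (k, i))"
    using feasible_carrier[OF X]
    by (simp add: mat_trace_def laplacian_def scalar_prod_def lessThan_atLeast0)
  also have "\<dots> = (\<Sum>i<n. \<Sum>k<n. \<Sum>j<n. w (cycle_edge n j) * (d j i * d j k * X $$ (i, k)))"
    using feasible_sym[OF X]
    by (intro sum.cong refl) (simp add: laplacian_cycle_entry[OF n] d_def sum_distrib_left sum_distrib_right mult_ac)
  also have "\<dots> = (\<Sum>i<n. \<Sum>j<n. \<Sum>k<n. w (cycle_edge n j) * (d j i * d j k * X $$ (i, k)))"
    by (intro sum.cong refl sum.swap)
  also have "\<dots> = (\<Sum>j<n. \<Sum>i<n. \<Sum>k<n. w (cycle_edge n j) * (d j i * d j k * X $$ (i, k)))"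
    by (rule sum.swap)
  also have "\<dots> = (\<Sum>j<n. w (cycle_edge n j) * bilin n X (d j) (d j))"
    by (simp add: bilin_def sum_distrib_left)
  also have "\<dots> = (\<Sum>j<n. 2 * (w (cycle_edge n j) * (1 - X $$ (j, (j + 1) mod n))))"
  proof (intro sum.cong refl)
    fix j assume "j \<in> {..<n}"
    then have "bilin n X (d j) (d j) = 2 * (1 - X $$ (j, (j + 1) mod n))"
      using bilin_unit_combination[OF X, of j "(j + 1) mod n" 1 "-1"] cycle_edge_no_loop[OF n, of j]
      unfolding d_def by simp
    then show "w (cycle_edge n j) * bilin n X (d j) (d j)
        = 2 * (w (cycle_edge n j) * (1 - X $$ (j, (j + 1) mod n)))"
      by simp
  qed
  finally show ?thesis
    by (simp add: maxcut_sdp_objective_def sum_distrib_left)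
qed

text \<open>The total weight is a constant of the objective, so maximising it means minimising the
  weighted sum of the edge entries.\<close>

lemma optimal_cycle_iff:
  assumes n: "n \<ge> 3" and X: "maxcut_sdp_feasible n X"
  shows "maxcut_sdp_optimal n (cycle_edges n) w X \<longleftrightarrow>
    (\<forall>Y. maxcut_sdp_feasible n Y \<longrightarrow>
      (\<Sum>j<n. w (cycle_edge n j) * X $$ (j, (j + 1) mod n))
        \<le> (\<Sum>j<n. w (cycle_edge n j) * Y $$ (j, (j + 1) mod n)))"
  using X unfolding maxcut_sdp_optimal_def
  by (auto simp: objective_cycle[OF n] right_diff_distrib sum_subtractf)

section \<open>Sign patterns around the cycle\<close>

lemma sum_cyclic_shift: "(\<Sum>i<n. g ((i + 1) mod n)) = (\<Sum>i<n. g i)" for n :: nat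
proof (cases n)
  case (Suc m)
  have "(\<Sum>i<Suc m. g ((i + 1) mod Suc m)) = (\<Sum>i<m. g (Suc i)) + g 0"
    by simp
  also have "\<dots> = (\<Sum>i<Suc m. g i)"
    by (simp only: sum.lessThan_Suc_shift add.commute)
  finally show ?thesis using Suc by simp
qed simp

lemma prod_cyclic_shift: "(\<Prod>i<n. g ((i + 1) mod n)) = (\<Prod>i<n. g i)" for n :: nat
proof (cases n)
  case (Suc m)
  have "(\<Prod>i<Suc m. g ((i + 1) mod Suc m)) = (\<Prod>i<m. g (Suc i)) * g 0"
    by simp
  also have "\<dots> = (\<Prod>i<Suc m. g i)"
    by (simp only: prod.lessThan_Suc_shift mult.commute)
  finally show ?thesis using Suc by simp
qed simp

text \<open>The vertex signs are partial products of the edge signs; the total product being 1 makes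
  the closing edge back to vertex 0 come out right.\<close>

lemma cyclic_signs:
  fixes t :: "nat \<Rightarrow> real"
  assumes t: "\<And>j. j < n \<Longrightarrow> t j * t j = 1" and prod: "(\<Prod>j<n. t j) = 1"
  obtains s :: "nat \<Rightarrow> real" where "\<And>i. i < n \<Longrightarrow> s i * s i = 1" "\<And>j. j < n \<Longrightarrow> s j * s ((j + 1) mod n) = t j"
proof -
  define s where "s i = (\<Prod>j<i. t j)" for i
  have s: "s i * s i = 1" if "i < n" for i
    using that t by (simp add: s_def prod.distrib[symmetric])
  have "s j * s ((j + 1) mod n) = t j" if j: "j < n" for j
  proof (cases "Suc j = n")
    case True
    have "s j * t j = 1"
      using prod True by (auto simp: s_def)
    then have "s j = t j"
      using t[OF j] by (metis mult.assoc mult.left_neutral mult.right_neutral)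
    then show ?thesis
      using True by (simp add: s_def)
  next
    case False
    have "s (Suc j) = s j * t j"
      by (simp add: s_def)
    with False j show ?thesis
      using s[OF j] by (simp add: mult.assoc[symmetric])
  qed
  with s show ?thesis using that by blast
qed

text \<open>Sufficiency is thereby reduced to finding edge signs with product 1 whose weighted sum
  is a lower bound for all feasible matrices.\<close>

lemma sign_pattern_optimal:
  fixes t :: "nat \<Rightarrow> real"
  assumes n: "n \<ge> 3" and t: "\<And>j. j < n \<Longrightarrow> t j * t j = 1" "(\<Prod>j<n. t j) = 1"
    and bound: "\<And>Y. maxcut_sdp_feasible n Y \<Longrightarrow>
      (\<Sum>j<n. w (cycle_edge n j) * t j) \<le> (\<Sum>j<n. w (cycle_edge n j) * Y $$ (j, (j + 1) mod n))"
  shows "\<exists>X. maxcut_sdp_optimal n (cycle_edges n) w X \<and> vec_space.rank n X = 1"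
proof -
  obtain s where s: "\<And>i. i < n \<Longrightarrow> s i * s i = 1" "\<And>j. j < n \<Longrightarrow> s j * s ((j + 1) mod n) = t j"
    using cyclic_signs[OF t] by blast
  define X where "X = mat n n (\<lambda>(i, j). s i * s j)"
  have X: "maxcut_sdp_feasible n X"
    using planar_feasible[OF s(1), where \<phi> = "\<lambda>_. 0"] by (simp add: X_def)
  have "(\<Sum>j<n. w (cycle_edge n j) * X $$ (j, (j + 1) mod n)) = (\<Sum>j<n. w (cycle_edge n j) * t j)"
    using s(2) by (intro sum.cong refl) (simp add: X_def)
  then have "maxcut_sdp_optimal n (cycle_edges n) w X"
    using bound by (simp add: optimal_cycle_iff[OF n X])
  moreover have "vec_space.rank n X = 1"
    unfolding X_def using n s(1)[of 0] by (intro rank_one_sign_mat) auto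
  ultimately show ?thesis by blast
qed

text \<open>Opposing the sign of every positive weight minimises all edge terms at once; parity
  decides whether this pattern closes up around the cycle.\<close>

lemma prod_signs_positive_edges:
  assumes "n \<ge> 3"
  shows "(\<Prod>j<n. if w (cycle_edge n j) > 0 then - 1 else 1 :: real) =
    (- 1) ^ card {e \<in> cycle_edges n. w e > (0 :: real)}"
proof -
  have "(\<Prod>j<n. if w (cycle_edge n j) > 0 then - 1 else 1 :: real)
      = (\<Prod>e\<in>cycle_edges n. if w e > 0 then - 1 else 1)"
    unfolding cycle_edges_def using cycle_edge_inj[OF assms]
    by (subst prod.reindex) (auto simp: lessThan_atLeast0)
  also have "\<dots> = (\<Prod>e\<in>{e \<in> cycle_edges n. w e > 0}. - 1)"
    by (rule prod.inter_filter[symmetric]) (simp add: cycle_edges_def)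
  finally show ?thesis by simp
qed

section \<open>Sufficiency of the two conditions\<close>

lemma feasible_edge_bound:
  assumes "maxcut_sdp_feasible n Y" "a < n" "b < n"
  shows "- \<bar>c\<bar> \<le> c * Y $$ (a, b)"
proof -
  have "\<bar>c * Y $$ (a, b)\<bar> \<le> \<bar>c\<bar> * 1"
    unfolding abs_mult by (intro mult_left_mono feasible_entry_abs_le_1[OF assms]) simp
  then show ?thesis by linarith
qed

text \<open>Cauchy-Schwarz and \<open>T\<close> bound
  \<open>\<bar>W m\<bar> * bilin n Y (y m) (y m)\<close> by the sum of the same terms over the other
  edges. As \<open>\<bar>W i\<bar> * t i\<close> is \<open>W m\<close> at \<open>m\<close> and
  \<open>- W i\<close> elsewhere, this is twice the claim, rearranged.\<close>

lemma flipped_edge_bound: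
  fixes W t :: "nat \<Rightarrow> real"
  assumes n: "n \<ge> 3" and Y: "maxcut_sdp_feasible n Y" and m: "m < n"
    and t: "\<And>j. j < n \<Longrightarrow> t j * t j = 1" "(\<Prod>j<n. t j) = 1"
    and W: "\<And>j. j < n \<Longrightarrow> W j \<noteq> 0" "W m * t m = \<bar>W m\<bar>"
      "\<And>j. j < n \<Longrightarrow> j \<noteq> m \<Longrightarrow> W j * t j = - \<bar>W j\<bar>"
    and T: "(\<Sum>i\<in>{..<n} - {m}. 1 / \<bar>W i\<bar>) \<le> 1 / \<bar>W m\<bar>"
  shows "(\<Sum>j<n. W j * t j) \<le> (\<Sum>j<n. W j * Y $$ (j, (j + 1) mod n))"
proof -
  define A where "A = {..<n} - {m}"
  obtain s where s: "\<And>i. i < n \<Longrightarrow> s i * s i = 1" "\<And>j. j < n \<Longrightarrow> s j * s ((j + 1) mod n) = t j"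
    using cyclic_signs[OF t] by blast
  define y where "y i k = s i * unit_fun i k + - s ((i + 1) mod n) * unit_fun ((i + 1) mod n) k" for i k
  have yy: "bilin n Y (y i) (y i) = 2 - 2 * (t i * Y $$ (i, (i + 1) mod n))" if "i < n" for i
  proof -
    have "(i + 1) mod n < n" using that by simp
    then show ?thesis
      using bilin_unit_combination[OF Y that, of "(i + 1) mod n" "s i" "- s ((i + 1) mod n)"]
        s(1)[OF that] s(1)[of "(i + 1) mod n"] s(2)[OF that]
      unfolding y_def by (simp add: power2_eq_square)
  qed
  \<comment> \<open>The differences cancel around the cycle, so the one at \<open>m\<close> is minus
    the sum of the others.\<close>
  have "(\<Sum>i<n. y i k) = 0" for k
    using sum_cyclic_shift[of "\<lambda>i. s i * unit_fun i k" n] by (simp add: y_def sum_subtractf)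
  then have z: "- 1 * y m k = (\<Sum>i\<in>A. y i k)" for k
    using m sum.remove[of "{..<n}" m "\<lambda>i. y i k"] by (simp add: A_def add_eq_0_iff)
  have distrib: "a * (2 - 2 * (b * c)) = 2 * a - 2 * (a * b * c)" for a b c :: real
    by (simp add: algebra_simps)
  \<comment> \<open>Cauchy-Schwarz divides by the total of the reciprocals, which is positive once
    some edge besides \<open>m\<close> exists.\<close>
  have "A \<noteq> {}"
  proof -
    have "(if m = 0 then 1 else 0) \<in> A" using n by (auto simp: A_def)
    then show ?thesis by blast
  qed
  then have Tpos: "(\<Sum>i\<in>A. 1 / \<bar>W i\<bar>) > 0"
    using W(1) by (intro sum_pos) (auto simp: A_def)
  define S where "S = (\<Sum>i\<in>A. \<bar>W i\<bar> * bilin n Y (y i) (y i))"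
  have "bilin n Y (\<lambda>k. - 1 * y m k) (\<lambda>k. - 1 * y m k) \<le> (\<Sum>i\<in>A. 1 / \<bar>W i\<bar>) * S"
    unfolding S_def
    by (rule weighted_Cauchy_Schwarz[OF Y _ _ refl Tpos z]) (use W(1) in \<open>auto simp: A_def\<close>)
  also have "\<dots> \<le> 1 / \<bar>W m\<bar> * S"
    unfolding S_def using T feasible_bilin_nonneg[OF Y]
    by (intro mult_right_mono sum_nonneg) (auto simp: A_def)
  finally have "\<bar>W m\<bar> * bilin n Y (y m) (y m) \<le> S"
    using W(1)[OF m] unfolding bilin_scale_left bilin_scale_right by (simp add: field_simps)
  moreover have "\<bar>W m\<bar> * bilin n Y (y m) (y m) = 2 * (W m * t m) - 2 * (W m * Y $$ (m, (m + 1) mod n))"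
  proof -
    have "\<bar>W m\<bar> * t m = W m"
      using W(2) t(1)[OF m] by (metis mult.assoc mult.right_neutral)
    then show ?thesis
      unfolding yy[OF m] W(2) distrib by simp
  qed
  moreover have "S = (\<Sum>i\<in>A. 2 * (W i * Y $$ (i, (i + 1) mod n)) - 2 * (W i * t i))"
    unfolding S_def
  proof (intro sum.cong refl)
    fix i assume "i \<in> A"
    then have i: "i < n" "W i * t i = - \<bar>W i\<bar>"
      using W(3) by (auto simp: A_def)
    have "\<bar>W i\<bar> * t i = - (W i * (t i * t i))"
      using i(2) by (simp flip: mult.assoc)
    also have "\<dots> = - W i"
      using t(1)[OF i(1)] by simp
    finally show "\<bar>W i\<bar> * bilin n Y (y i) (y i) = 2 * (W i * Y $$ (i, (i + 1) mod n)) - 2 * (W i * t i)"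
      unfolding yy[OF i(1)] i(2) distrib by simp
  qed
  ultimately show ?thesis
    using m by (simp add: sum.remove[of "{..<n}" m] A_def sum_subtractf sum_distrib_left[symmetric])
qed

section \<open>Necessity of the two conditions\<close>

text \<open>Near 0, \<open>1 - cos x\<close> behaves like \<open>x\<^sup>2 / 2\<close>, so any
  factor below 1 leaves room. The half-angle formula reduces this to the cubic bound for the
  sine.\<close>

lemma one_minus_cos_lower:
  fixes c :: real
  assumes "0 \<le> c" "c < 1"
  obtains x where "x > 0" "1 - cos x > c * x\<^sup>2 / 2"
proof -
  \<comment> \<open>With this choice \<open>y\<^sup>2 \<le> y\<close> yields
    \<open>1 - y\<^sup>2 / 3 > 1 - y = c\<close>; the witness is the double angle
    \<open>2 * y\<close>.\<close>
  define y where "y = 1 - c"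
  have y: "0 < y" "y \<le> 1" using assms by (auto simp: y_def)
  have "\<bar>sin y - y\<bar> \<le> y ^ 3 / 6"
    using Maclaurin_sin_bound[of y 3] y by (simp add: numeral_3_eq_3 sin_coeff_def fact_numeral)
  moreover have "y * (1 - y\<^sup>2 / 6) = y - y ^ 3 / 6"
    by (simp add: power2_eq_square power3_eq_cube algebra_simps)
  ultimately have "sin y \<ge> y * (1 - y\<^sup>2 / 6)"
    by linarith
  moreover have y2: "y\<^sup>2 \<le> y" "0 < y\<^sup>2"
    using y by (auto simp: power2_eq_square mult_left_le)
  ultimately have "(sin y)\<^sup>2 \<ge> (y * (1 - y\<^sup>2 / 6))\<^sup>2"
    using y by (intro power_mono) auto
  moreover have "(1 - y\<^sup>2 / 6)\<^sup>2 > c"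
  proof -
    have "(1 - y\<^sup>2 / 6)\<^sup>2 \<ge> 1 - y\<^sup>2 / 3"
      by (simp add: power2_diff)
    moreover have "1 - y\<^sup>2 / 3 > c"
      using y y2 unfolding y_def by linarith
    ultimately show ?thesis by linarith
  qed
  ultimately have "(sin y)\<^sup>2 > y\<^sup>2 * c"
    using y2(2) by (smt (verit) mult_strict_left_mono power_mult_distrib)
  then have "1 - cos (2 * y) > c * (2 * y)\<^sup>2 / 2"
    using cos_double_sin[of y] by (simp add: power_mult_distrib mult_ac)
  with y show ?thesis using that[of "2 * y"] by simp
qed

lemma one_minus_cos_upper: "1 - cos x \<le> x\<^sup>2 / 2" for x :: real
proof -
  have "(sin (x / 2))\<^sup>2 \<le> (x / 2)\<^sup>2"
    using abs_sin_x_le_abs_x[of "x / 2"] by (simp only: abs_le_square_iff)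
  then show ?thesis
    using cos_double_sin[of "x / 2"] by (simp add: power_divide)
qed

text \<open>To second order edge \<open>m\<close> gains
  \<open>\<bar>W m\<bar> * (\<epsilon> * D)\<^sup>2 / 2\<close>, while the other edges together lose
  at most \<open>\<epsilon>\<^sup>2 * D / 2\<close>. The gain wins for small angles since
  \<open>\<bar>W m\<bar> * D > 1\<close>, which is \<open>T\<close>. Angles proportional to
  \<open>1 / \<bar>W j\<bar>\<close> make the quadratic loss bound least for a given total
  rotation.\<close>

lemma flipped_edge_improvable:
  fixes W s :: "nat \<Rightarrow> real"
  assumes n: "n \<ge> 3" and m: "m < n" and s: "\<And>i. i < n \<Longrightarrow> s i * s i = 1"
    and W: "\<And>j. j < n \<Longrightarrow> W j \<noteq> 0" "W m * (s m * s ((m + 1) mod n)) > 0"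
    and T: "(\<Sum>i\<in>{..<n} - {m}. 1 / \<bar>W i\<bar>) > 1 / \<bar>W m\<bar>"
  shows "\<exists>Y. maxcut_sdp_feasible n Y \<and>
    (\<Sum>j<n. W j * Y $$ (j, (j + 1) mod n)) < (\<Sum>j<n. W j * (s j * s ((j + 1) mod n)))"
proof -
  define t where "t j = s j * s ((j + 1) mod n)" for j
  define A where "A = {..<n} - {m}"
  define D where "D = (\<Sum>i\<in>A. 1 / \<bar>W i\<bar>)"
  define S where "S = (\<Sum>i<n. 1 / \<bar>W i\<bar>)"
  have S: "S = 1 / \<bar>W m\<bar> + D"
    using m by (simp add: S_def D_def A_def sum.remove[of "{..<n}" m])
  have D: "D > 1 / \<bar>W m\<bar>" "D > 0"
    using T W(1)[OF m] unfolding D_def A_def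
    by (auto intro: less_trans[of 0 "1 / \<bar>W m\<bar>"])
  have abs_t: "\<bar>t j\<bar> = 1" if "j < n" for j
  proof -
    have "(j + 1) mod n < n" using that by simp
    then have "\<bar>s j\<bar> = 1 \<and> \<bar>s ((j + 1) mod n)\<bar> = 1"
      using s that by (metis abs_1 abs_mult_self_eq abs_square_eq_1 power2_eq_square)
    then show ?thesis by (simp add: t_def abs_mult)
  qed
  \<comment> \<open>Rotate by \<open>\<epsilon> / \<bar>W j\<bar>\<close> along every edge but \<open>m\<close>, which then has to undo the total rotation \<open>\<epsilon> * D\<close>.\<close>
  define q where "q i = (\<Sum>j<i. 1 / \<bar>W j\<bar>) - (if m < i then S else 0)" for i
  have q: "q j - q ((j + 1) mod n) = (if j = m then D else - (1 / \<bar>W j\<bar>))" if j: "j < n" for j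
  \<comment> \<open>The last edge leads back to \<open>q 0 = 0\<close>; the drop by \<open>S\<close>
    after \<open>m\<close> makes the angles close up.\<close>
  proof (cases "Suc j = n")
    case True
    then have "S = (\<Sum>i<j. 1 / \<bar>W i\<bar>) + 1 / \<bar>W j\<bar>"
      unfolding S_def True[symmetric] by simp
    moreover have "m < j \<longleftrightarrow> j \<noteq> m" using True m by auto
    ultimately show ?thesis
      using True S by (auto simp: q_def)
  next
    case False
    then have "(j + 1) mod n = Suc j" using j by simp
    then show ?thesis
      using S by (auto simp: q_def)
  qed
  \<comment> \<open>This ratio compares the loss bound with the second-order gain; it is below 1 by
    \<open>T\<close>.\<close>
  have "0 \<le> 1 / (\<bar>W m\<bar> * D)" "1 / (\<bar>W m\<bar> * D) < 1"
    using D W(1)[OF m] by (auto simp: field_simps)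
  then obtain x where x: "x > 0" "1 - cos x > 1 / (\<bar>W m\<bar> * D) * x\<^sup>2 / 2"
    by (rule one_minus_cos_lower)
  \<comment> \<open>Edge \<open>m\<close> then turns by \<open>\<epsilon> * D = x\<close>, the angle
    for which the cosine bound was obtained.\<close>
  define \<epsilon> where "\<epsilon> = x / D"
  define Y where "Y = mat n n (\<lambda>(i, j). s i * s j * cos (\<epsilon> * q i - \<epsilon> * q j))"
  have Y: "maxcut_sdp_feasible n Y"
    unfolding Y_def by (rule planar_feasible[OF s])
  have entry: "Y $$ (j, (j + 1) mod n) = t j * cos (\<epsilon> * (q j - q ((j + 1) mod n)))" if "j < n" for j
    using that by (simp add: Y_def t_def right_diff_distrib)
  have "(\<Sum>j<n. W j * t j) - (\<Sum>j<n. W j * Y $$ (j, (j + 1) mod n))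
      = (\<Sum>j<n. W j * t j * (1 - cos (\<epsilon> * (q j - q ((j + 1) mod n)))))"
    unfolding sum_subtractf[symmetric]
    by (intro sum.cong refl) (use entry in \<open>simp add: algebra_simps\<close>)
  also have "\<dots> = W m * t m * (1 - cos x) + (\<Sum>j\<in>A. W j * t j * (1 - cos (\<epsilon> / \<bar>W j\<bar>)))"
  proof -
    have "(\<Sum>j\<in>A. W j * t j * (1 - cos (\<epsilon> * (q j - q ((j + 1) mod n)))))
        = (\<Sum>j\<in>A. W j * t j * (1 - cos (\<epsilon> / \<bar>W j\<bar>)))"
      by (intro sum.cong refl) (use q in \<open>auto simp: A_def\<close>)
    moreover have "\<epsilon> * (q m - q ((m + 1) mod n)) = x"
      using q[OF m] D by (simp add: \<epsilon>_def)
    ultimately show ?thesis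
      using m by (subst sum.remove[of "{..<n}" m]) (auto simp: A_def)
  qed
  \<comment> \<open>The other edges may carry either sign, so each is charged its worst
    case.\<close>
  also have "\<dots> \<ge> \<bar>W m\<bar> * (1 - cos x) + (\<Sum>j\<in>A. - (\<epsilon>\<^sup>2 / 2 * (1 / \<bar>W j\<bar>)))"
  proof (intro add_mono sum_mono)
    have "W m * t m = \<bar>W m\<bar>"
      using W(2) abs_t[OF m] unfolding t_def[symmetric] by (metis abs_mult abs_of_pos mult.right_neutral)
    then show "\<bar>W m\<bar> * (1 - cos x) \<le> W m * t m * (1 - cos x)" by simp
  next
    fix j assume "j \<in> A"
    then have j: "j < n" "W j \<noteq> 0" using W(1) by (auto simp: A_def)
    have "\<bar>W j * t j * (1 - cos (\<epsilon> / \<bar>W j\<bar>))\<bar> \<le> \<bar>W j\<bar> * ((\<epsilon> / \<bar>W j\<bar>)\<^sup>2 / 2)"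
      unfolding abs_mult abs_t[OF j(1)]
      using one_minus_cos_upper[of "\<epsilon> / \<bar>W j\<bar>"] by (intro mult_mono) auto
    also have "\<dots> = \<epsilon>\<^sup>2 / 2 * (1 / \<bar>W j\<bar>)"
      using j(2) by (simp add: power_divide) (simp add: power2_eq_square field_simps flip: abs_mult)
    finally show "- (\<epsilon>\<^sup>2 / 2 * (1 / \<bar>W j\<bar>)) \<le> W j * t j * (1 - cos (\<epsilon> / \<bar>W j\<bar>))"
      by linarith
  qed
  also have "(\<Sum>j\<in>A. - (\<epsilon>\<^sup>2 / 2 * (1 / \<bar>W j\<bar>))) = - (\<epsilon>\<^sup>2 / 2 * D)"
    by (simp add: D_def sum_negf sum_distrib_left)
  finally have "(\<Sum>j<n. W j * t j) - (\<Sum>j<n. W j * Y $$ (j, (j + 1) mod n))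
      \<ge> \<bar>W m\<bar> * (1 - cos x) - \<epsilon>\<^sup>2 / 2 * D"
    by simp
  moreover have "\<bar>W m\<bar> * (1 - cos x) > \<epsilon>\<^sup>2 / 2 * D"
  proof -
    have "\<epsilon>\<^sup>2 / 2 * D = \<bar>W m\<bar> * (1 / (\<bar>W m\<bar> * D) * x\<^sup>2 / 2)"
      using D W(1)[OF m] by (simp add: \<epsilon>_def power2_eq_square)
    also have "\<dots> < \<bar>W m\<bar> * (1 - cos x)"
      using x W(1)[OF m] by (intro mult_strict_left_mono) auto
    finally show ?thesis .
  qed
  ultimately show ?thesis
    using Y unfolding t_def by (intro exI[of _ Y]) auto
qed

section \<open>The equivalence, with zero weights as infinite reciprocals\<close>

lemma recip_abs_eq: "recip_abs x = (if x = 0 then \<infinity> else ereal (1 / \<bar>x\<bar>))"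
  by (simp add: recip_abs_def one_ereal_def)

theorem theorem2:
  fixes n :: nat and w :: "nat set \<Rightarrow> real"
  assumes "n \<ge> 3"
  shows "(\<exists>X. maxcut_sdp_optimal n (cycle_edges n) w X \<and> vec_space.rank n X = 1) \<longleftrightarrow>
    even (card {e \<in> cycle_edges n. w e > 0}) \<or>
    (\<exists>m<n. recip_abs (w (cycle_edge n m)) \<ge>
       (\<Sum>i\<in>{0..<n} - {m}. recip_abs (w (cycle_edge n i))))"
    (is "?rank_one \<longleftrightarrow> ?even \<or> ?dominant")
proof
  note n = assms
  define W where "W j = w (cycle_edge n j)" for j
  \<comment> \<open>These signs minimise every edge term. A zero weight gets the default 1, in line
    with counting only strictly positive edges.\<close>
  define p where "p j = (if W j > 0 then - 1 else 1 :: real)" for j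
  have prod_p: "(\<Prod>j<n. p j) = (if ?even then 1 else - 1)"
    using prod_signs_positive_edges[OF n, of w] by (simp add: p_def W_def)
  {
    assume ?rank_one
    then obtain X where opt: "maxcut_sdp_optimal n (cycle_edges n) w X" and rk: "vec_space.rank n X = 1"
      by blast
    then have X: "maxcut_sdp_feasible n X" by (simp add: maxcut_sdp_optimal_def)
    obtain s where s: "\<And>i. i < n \<Longrightarrow> s i * s i = 1" "\<And>i j. i < n \<Longrightarrow> j < n \<Longrightarrow> X $$ (i, j) = s i * s j"
      using feasible_rank_one[OF X rk] n by auto
    have X_sum: "(\<Sum>j<n. W j * X $$ (j, (j + 1) mod n)) = (\<Sum>j<n. W j * (s j * s ((j + 1) mod n)))"
      using s(2) by (intro sum.cong refl) simp
    show "?even \<or> ?dominant"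
    proof (rule ccontr)
      assume contra: "\<not> (?even \<or> ?dominant)"
      have dom: "recip_abs (W m) < (\<Sum>i\<in>{..<n} - {m}. recip_abs (W i))" if "m < n" for m
        using contra that by (auto simp: W_def lessThan_atLeast0 not_le)
      \<comment> \<open>A zero weight would have an infinite reciprocal and hence dominate.\<close>
      have W: "W j \<noteq> 0" if "j < n" for j
        using dom[OF that] by (auto simp: recip_abs_eq)
      have T: "1 / \<bar>W m\<bar> < (\<Sum>i\<in>{..<n} - {m}. 1 / \<bar>W i\<bar>)" if "m < n" for m
      proof -
        have "(\<Sum>i\<in>{..<n} - {m}. recip_abs (W i)) = ereal (\<Sum>i\<in>{..<n} - {m}. 1 / \<bar>W i\<bar>)"
          unfolding sum_ereal[symmetric] using W by (intro sum.cong refl) (simp add: recip_abs_eq)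
        with dom[OF that] W[OF that] show ?thesis by (simp add: recip_abs_eq)
      qed
      \<comment> \<open>Otherwise the edge signs would all agree with \<open>p\<close>, whose
        product is -1 in the odd case, whereas each vertex sign enters the product around the cycle
        twice.\<close>
      have "\<exists>m<n. W m * (s m * s ((m + 1) mod n)) > 0"
      proof (rule ccontr)
        assume none: "\<not> ?thesis"
        have "s j * s ((j + 1) mod n) = p j" if j: "j < n" for j
        proof -
          have "(s j * s ((j + 1) mod n))\<^sup>2 = (s j * s j) * (s ((j + 1) mod n) * s ((j + 1) mod n))"
            by (simp add: power2_eq_square mult_ac)
          then have "(s j * s ((j + 1) mod n))\<^sup>2 = 1"
            using s(1)[OF j] s(1)[of "(j + 1) mod n"] j by simp
          then have "s j * s ((j + 1) mod n) = 1 \<or> s j * s ((j + 1) mod n) = - 1"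
            by (simp only: power2_eq_1_iff)
          moreover have "W j * (s j * s ((j + 1) mod n)) \<le> 0"
            using none j by force
          ultimately show ?thesis
            using W[OF j] by (auto simp: p_def)
        qed
        then have "(\<Prod>j<n. p j) = (\<Prod>j<n. s j * s ((j + 1) mod n))"
          by simp
        also have "\<dots> = (\<Prod>j<n. s j * s j)"
          using prod_cyclic_shift[of s n] by (simp only: prod.distrib)
        also have "\<dots> = 1"
          using s(1) by simp
        finally show False
          using contra prod_p by simp
      qed
      then obtain m where m: "m < n" "W m * (s m * s ((m + 1) mod n)) > 0" by blast
      obtain Y where "maxcut_sdp_feasible n Y"
        "(\<Sum>j<n. W j * Y $$ (j, (j + 1) mod n)) < (\<Sum>j<n. W j * (s j * s ((j + 1) mod n)))"
        using flipped_edge_improvable[OF n m(1) s(1) W m(2) T[OF m(1)]] by blast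
      then show False
        using opt X_sum unfolding optimal_cycle_iff[OF n X] W_def by force
    qed
  }
  {
    assume "?even \<or> ?dominant"
    have pp: "p j * p j = 1" "W j * p j = - \<bar>W j\<bar>" for j
      by (auto simp: p_def)
    have p_bound: "W j * p j \<le> W j * Y $$ (j, (j + 1) mod n)"
      if "maxcut_sdp_feasible n Y" "j < n" for Y j
      using feasible_edge_bound[OF that(1,2), of "(j + 1) mod n" "W j"] that(2) by (simp add: pp)
    show ?rank_one
    proof (cases ?even)
      case True
      show ?thesis
      proof (rule sign_pattern_optimal[OF n, of p])
        show "(\<Sum>j<n. w (cycle_edge n j) * p j) \<le> (\<Sum>j<n. w (cycle_edge n j) * Y $$ (j, (j + 1) mod n))"
          if "maxcut_sdp_feasible n Y" for Y
          using p_bound[OF that] unfolding W_def by (intro sum_mono) auto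
      qed (use pp prod_p True in auto)
    next
      case False
      with \<open>?even \<or> ?dominant\<close> obtain m where m: "m < n"
        and dom: "(\<Sum>i\<in>{..<n} - {m}. recip_abs (W i)) \<le> recip_abs (W m)"
        by (auto simp: W_def lessThan_atLeast0)
      \<comment> \<open>One flip repairs the product -1 of \<open>p\<close>, and the dominant edge
        is where it is made.\<close>
      define t where "t = p(m := - p m)"
      have t: "t j * t j = 1" for j
        using pp(1) by (simp add: t_def)
      have prod_t: "(\<Prod>j<n. t j) = 1"
      proof -
        have "(\<Prod>j<n. t j) = - (\<Prod>j<n. p j)"
          using m by (simp add: prod.remove[of "{..<n}" m] t_def)
        with prod_p False show ?thesis by simp
      qed
      show ?thesis
      proof (rule sign_pattern_optimal[OF n t prod_t])
        fix Y assume Y: "maxcut_sdp_feasible n Y"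
        have "(\<Sum>j<n. W j * t j) \<le> (\<Sum>j<n. W j * Y $$ (j, (j + 1) mod n))"
        \<comment> \<open>Flipping an edge of weight zero costs nothing, so the termwise bound for
          \<open>p\<close> still applies.\<close>
        proof (cases "W m = 0")
          case True
          then have "W j * t j \<le> W j * Y $$ (j, (j + 1) mod n)" if "j < n" for j
            using p_bound[OF Y that] by (cases "j = m") (simp_all add: t_def)
          then show ?thesis
            by (intro sum_mono) auto
        next
          case False
          \<comment> \<open>The reciprocal at \<open>m\<close> is now finite, so no reciprocal in
            the sum it bounds can be infinite.\<close>
          have W: "W j \<noteq> 0" if j: "j < n" for j
          proof
            assume "W j = 0"
            with False have "j \<in> {..<n} - {m}" "recip_abs (W j) = \<infinity>"
              using j by (auto simp: recip_abs_eq)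
            then have "(\<Sum>i\<in>{..<n} - {m}. recip_abs (W i)) = \<infinity>"
              by (subst sum_Pinfty) auto
            with dom False show False by (simp add: recip_abs_eq)
          qed
          have "(\<Sum>i\<in>{..<n} - {m}. recip_abs (W i)) = ereal (\<Sum>i\<in>{..<n} - {m}. 1 / \<bar>W i\<bar>)"
            unfolding sum_ereal[symmetric] using W by (intro sum.cong refl) (simp add: recip_abs_eq)
          with dom False have "(\<Sum>i\<in>{..<n} - {m}. 1 / \<bar>W i\<bar>) \<le> 1 / \<bar>W m\<bar>"
            by (simp add: recip_abs_eq)
          then show ?thesis
            by (intro flipped_edge_bound[OF n Y m t prod_t W]) (auto simp: t_def pp)
        qed
        then show "(\<Sum>j<n. w (cycle_edge n j) * t j) \<le> (\<Sum>j<n. w (cycle_edge n j) * Y $$ (j, (j + 1) mod n))"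
          by (simp add: W_def)
      qed
    qed
  }
qed

end
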